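(* Let $\mathbb{X}$ be a locally compact second countable Hausdorff space with Borel $\sigma$-field $\mathcal{X}$, and let $\xi$ and $\zeta$ be two point processes on $\mathbb{X}$ with finite intensity measure. Then $$d_\pi(\xi,\zeta)\le 2\,d_{KR}(\xi,\zeta).$$
   Context: $\mathsf{N}_{\mathbb{X}}$ is the collection of all $\sigma$-finite counting measures on $(\mathbb{X},\mathcal{X})$, equipped with the smallest $\sigma$-field $\mathcal{N}_{\mathbb{X}}$ making $\nu\mapsto\nu(B)$ measurable for all $B\in\mathcal{X}$. A point process on $\mathbb{X}$ is a random element of $(\mathsf{N}_{\mathbb{X}},\mathcal{N}_{\mathbb{X}})$; its intensity measure is $B\mapsto\mathbb{E}[\xi(B)]$, $B\in\mathcal{X}$. $\mathcal{X}^d_{\mathrm{disj}}=\{(A_1,\dots,A_d)\in\mathcal{X}^d: A_i\cap A_j=\emptyset,\ i\neq j\}$. For point processes $\xi,\zeta$ on $\mathbb{X}$ with finite intensity measure, $$d_\pi(\xi,\zeta)=\sup_{(A_1,\dots,A_d)\in\mathcal{X}^d_{\mathrm{disj}},\,d\in\mathbb{N}}d_W\big((\xi(A_1),\dots,\xi(A_d)),(\zeta(A_1),\dots,\zeta(A_d))\big),$$ where, with $\mathbb{N}_0=\mathbb{N}\cup\{0\}$, for integrable random vectors $\mathbf{X},\mathbf{Y}$ in $\mathbb{N}_0^d$, $d_W(\mathbf{X},\mathbf{Y})=\sup_{g}|\mathbb{E}[g(\mathbf{X})]-\mathbb{E}[g(\mathbf{Y})]|$, the supremum being over all $g:\mathbb{N}_0^d\to\mathbb{R}$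 with $|g(\mathbf{x})-g(\mathbf{y})|\le\sum_{i=1}^d|x_i-y_i|$ for all $\mathbf{x},\mathbf{y}\in\mathbb{N}_0^d$. (When the intensity measure is finite, these vectors take values in $\mathbb{N}_0^d$ almost surely.) The Kantorovich-Rubinstein distance is $$d_{KR}(\xi,\zeta)=\sup_{h\in\mathcal{L}(1)}\big|\mathbb{E}[h(\xi)]-\mathbb{E}[h(\zeta)]\big|,$$ where $\mathcal{L}(1)$ is the set of all measurable functions $h:\mathsf{N}_{\mathbb{X}}\to\mathbb{R}$ that are Lipschitz continuous with Lipschitz constant at most $1$ with respect to the total variation distance between measures $$d_{TV,\mathsf{N}_{\mathbb{X}}}(\mu,\nu)=\sup_{\substack{A\in\mathcal{X}\\ \mu(A),\nu(A)<\infty}}|\mu(A)-\nu(A)|,\quad\mu,\nu\in\mathsf{N}_{\mathbb{X}}$$ (and for which $h(\xi)$ and $h(\zeta)$ are integrable). Since $\xi$ and $\zeta$ almost surely take values in the set $\mathsf{N}_{\mathbb{X}}^{<\infty}=\{\nu\in\mathsf{N}_{\mathbb{X}}:\nu(\mathbb{X})<\infty\}$, the functions $h$ may equivalently be taken to be defined on $\mathsf{N}_{\mathbb{X}}^{<\infty}$ only. *)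

theory Defs
  imports "HOL-Probability.Probability"
begin

text \<open>
  The state space is a topological type with its Borel sigma-field \<open>borel\<close>. All distances are
  \<open>ennreal\<close>-valued, so that every supremum below is taken in a complete lattice and no
  boundedness condition is hidden in it.
\<close>

definition counting_measures :: "'a::topological_space measure set" where
  "counting_measures =
     {\<nu>. sets \<nu> = sets borel \<and> sigma_finite_measure \<nu> \<and>
         (\<forall>B\<in>sets borel. emeasure \<nu> B \<in> \<nat> \<or> emeasure \<nu> B = \<infinity>)}"

text \<open>The same construction as \<^const>\<open>subprob_algebra\<close>.\<close>

definition counting_algebra :: "'a::topological_space measure measure" where
  "counting_algebra =
     (SUP B\<in>sets borel. vimage_algebra counting_measures (\<lambda>\<nu>. emeasure \<nu> B) borel)"

definition point_process ::
    "'w measure \<Rightarrow> ('w \<Rightarrow> 'a::topological_space measure) \<Rightarrow> bool" where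
  "point_process M \<xi> \<longleftrightarrow> prob_space M \<and> \<xi> \<in> M \<rightarrow>\<^sub>M counting_algebra"

definition intensity ::
    "'w measure \<Rightarrow> ('w \<Rightarrow> 'a::topological_space measure) \<Rightarrow> 'a measure" where
  "intensity M \<xi> =
     measure_of UNIV (sets borel) (\<lambda>B. \<integral>\<^sup>+\<omega>. emeasure (\<xi> \<omega>) B \<partial>M)"

text \<open>
  Vectors indexed by \<open>{..<d}\<close> are extensional functions on \<open>{..<d}\<close>. The two random vectors
  may live on different probability spaces.
\<close>

definition nat_vectors :: "nat \<Rightarrow> (nat \<Rightarrow> nat) set" where
  "nat_vectors d = {..<d} \<rightarrow>\<^sub>E UNIV"

definition lipschitz1_vec :: "nat \<Rightarrow> ((nat \<Rightarrow> nat) \<Rightarrow> real) set" where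
  "lipschitz1_vec d =
     {g. \<forall>x\<in>nat_vectors d. \<forall>y\<in>nat_vectors d.
           \<bar>g x - g y\<bar> \<le> (\<Sum>i<d. \<bar>real (x i) - real (y i)\<bar>)}"

definition dist_W ::
    "nat \<Rightarrow> 'w measure \<Rightarrow> ('w \<Rightarrow> nat \<Rightarrow> nat) \<Rightarrow> 'v measure \<Rightarrow> ('v \<Rightarrow> nat \<Rightarrow> nat) \<Rightarrow> ennreal" where
  "dist_W d M X N Y =
     (SUP g\<in>lipschitz1_vec d. ennreal \<bar>(\<integral>\<omega>. g (X \<omega>) \<partial>M) - (\<integral>\<omega>. g (Y \<omega>) \<partial>N)\<bar>)"

definition disjoint_borel_tuples :: "nat \<Rightarrow> (nat \<Rightarrow> 'a::topological_space set) set" where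
  "disjoint_borel_tuples d =
     {A. (\<forall>i<d. A i \<in> sets borel) \<and> disjoint_family_on A {..<d}}"

text \<open>
  For a counting measure, \<^term>\<open>measure \<nu> B\<close> is the natural number \<^term>\<open>emeasure \<nu> B\<close> when the
  latter is finite, and the floor only changes its type. An infinite mass is mapped to \<open>0\<close>; for
  point processes with finite intensity measure this concerns a null set only.
\<close>

definition count_vector ::
    "nat \<Rightarrow> (nat \<Rightarrow> 'a::topological_space set) \<Rightarrow> 'a measure \<Rightarrow> nat \<Rightarrow> nat" where
  "count_vector d A \<nu> = (\<lambda>i\<in>{..<d}. nat \<lfloor>measure \<nu> (A i)\<rfloor>)"

definition dist_pi ::
    "'w measure \<Rightarrow> ('w \<Rightarrow> 'a::topological_space measure) \<Rightarrow>
     'v measure \<Rightarrow> ('v \<Rightarrow> 'a measure) \<Rightarrow> ennreal" where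
  "dist_pi M \<xi> N \<zeta> =
     (SUP d\<in>{1..}. SUP A\<in>disjoint_borel_tuples d.
        dist_W d M (\<lambda>\<omega>. count_vector d A (\<xi> \<omega>)) N (\<lambda>\<omega>. count_vector d A (\<zeta> \<omega>)))"

definition dist_TV :: "'a::topological_space measure \<Rightarrow> 'a measure \<Rightarrow> ennreal" where
  "dist_TV \<mu> \<nu> =
     (SUP A\<in>{A \<in> sets borel. emeasure \<mu> A < \<infinity> \<and> emeasure \<nu> A < \<infinity>}.
        ennreal \<bar>measure \<mu> A - measure \<nu> A\<bar>)"

definition lipschitz1_TV :: "('a::topological_space measure \<Rightarrow> real) set" where
  "lipschitz1_TV =
     {h \<in> borel_measurable counting_algebra.
        \<forall>\<mu>\<in>counting_measures. \<forall>\<nu>\<in>counting_measures. ennreal \<bar>h \<mu> - h \<nu>\<bar> \<le> dist_TV \<mu> \<nu>}"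

definition dist_KR ::
    "'w measure \<Rightarrow> ('w \<Rightarrow> 'a::topological_space measure) \<Rightarrow>
     'v measure \<Rightarrow> ('v \<Rightarrow> 'a measure) \<Rightarrow> ennreal" where
  "dist_KR M \<xi> N \<zeta> =
     (SUP h\<in>{h \<in> lipschitz1_TV. integrable M (\<lambda>\<omega>. h (\<xi> \<omega>)) \<and> integrable N (\<lambda>\<omega>. h (\<zeta> \<omega>))}.
        ennreal \<bar>(\<integral>\<omega>. h (\<xi> \<omega>) \<partial>M) - (\<integral>\<omega>. h (\<zeta> \<omega>) \<partial>N)\<bar>)"

lemma space_counting_algebra: "space counting_algebra = counting_measures"
  by (auto simp add: space_Sup_eq_UN counting_algebra_def)

lemma measurable_emeasure_counting_algebra:
  assumes "B \<in> sets borel"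
  shows "(\<lambda>\<nu>. emeasure \<nu> B) \<in> borel_measurable counting_algebra"
  using assms by (auto intro!: measurable_Sup1 measurable_vimage_algebra1
      simp: counting_algebra_def space_Sup_eq_UN)

lemma point_process_in_counting_measures:
  assumes "point_process M \<xi>" "\<omega> \<in> space M"
  shows "\<xi> \<omega> \<in> counting_measures"
  using assms measurable_space[of \<xi> M counting_algebra \<omega>]
  by (simp add: point_process_def space_counting_algebra)

lemma point_process_measurable_emeasure:
  assumes "point_process M \<xi>" "B \<in> sets borel"
  shows "(\<lambda>\<omega>. emeasure (\<xi> \<omega>) B) \<in> borel_measurable M"
  using assms measurable_compose[OF _ measurable_emeasure_counting_algebra]
  by (auto simp: point_process_def)

lemma sets_intensity: "sets (intensity M \<xi>) = sets (borel :: 'a::topological_space measure)"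
  unfolding intensity_def using sets.sigma_sets_eq[of "borel :: 'a measure"] by simp

lemma emeasure_intensity:
  fixes \<xi> :: "'w \<Rightarrow> 'a::topological_space measure"
  assumes pp: "point_process M \<xi>" and B: "B \<in> sets borel"
  shows "emeasure (intensity M \<xi>) B = (\<integral>\<^sup>+\<omega>. emeasure (\<xi> \<omega>) B \<partial>M)"
proof (rule emeasure_measure_of[OF intensity_def])
  show "B \<in> sets (intensity M \<xi>)"
    using B by (simp add: sets_intensity)
  show "positive (sets (intensity M \<xi>)) (\<lambda>B. \<integral>\<^sup>+\<omega>. emeasure (\<xi> \<omega>) B \<partial>M)"
    by (simp add: positive_def)
  show "countably_additive (sets (intensity M \<xi>)) (\<lambda>B. \<integral>\<^sup>+\<omega>. emeasure (\<xi> \<omega>) B \<partial>M)"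
  proof (rule countably_additiveI)
    fix A :: "nat \<Rightarrow> 'a set"
    assume "range A \<subseteq> sets (intensity M \<xi>)" and disj: "disjoint_family A"
    then have A: "A i \<in> sets borel" for i
      by (auto simp: sets_intensity)
    have "(\<Sum>i. \<integral>\<^sup>+\<omega>. emeasure (\<xi> \<omega>) (A i) \<partial>M) = (\<integral>\<^sup>+\<omega>. (\<Sum>i. emeasure (\<xi> \<omega>) (A i)) \<partial>M)"
      using point_process_measurable_emeasure[OF pp A] by (simp add: nn_integral_suminf)
    also have "\<dots> = (\<integral>\<^sup>+\<omega>. emeasure (\<xi> \<omega>) (\<Union>i. A i) \<partial>M)"
    proof (rule nn_integral_cong)
      fix \<omega> assume "\<omega> \<in> space M"
      then have "sets (\<xi> \<omega>) = sets borel"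
        using point_process_in_counting_measures[OF pp] by (auto simp: counting_measures_def)
      then show "(\<Sum>i. emeasure (\<xi> \<omega>) (A i)) = emeasure (\<xi> \<omega>) (\<Union>i. A i)"
        using A disj by (intro suminf_emeasure) auto
    qed
    finally show "(\<Sum>i. \<integral>\<^sup>+\<omega>. emeasure (\<xi> \<omega>) (A i) \<partial>M) = (\<integral>\<^sup>+\<omega>. emeasure (\<xi> \<omega>) (\<Union>i. A i) \<partial>M)" .
  qed
qed auto

end

theory Submission
  imports Defs
begin

text \<open>
  A 1-Lipschitz \<open>g\<close> of the counts on disjoint sets gives a function \<open>\<nu> \<mapsto> g (\<nu>(A\<^sub>1), \<dots>, \<nu>(A\<^sub>d))\<close> that
  is 2-Lipschitz for the total variation distance: the sets with \<open>\<mu>(A\<^sub>i) \<ge> \<nu>(A\<^sub>i)\<close> and the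
  remaining ones have two unions, each of which contributes at most one total variation distance.
  Half of this function is therefore admissible for the Kantorovich-Rubinstein distance.
  Sets of infinite mass do no harm: if only one of \<open>\<mu>(A\<^sub>i)\<close>, \<open>\<nu>(A\<^sub>i)\<close> is infinite,
  then the total variation distance is infinite by \<open>\<sigma>\<close>-finiteness, and if both are infinite,
  then the \<open>i\<close>-th entries of both count vectors are \<open>0\<close>.
\<close>

lemma nat_floor_measure_counting:
  assumes "\<nu> \<in> counting_measures" "B \<in> sets borel"
  shows "real (nat \<lfloor>measure \<nu> B\<rfloor>) = measure \<nu> B"
proof -
  have "emeasure \<nu> B \<in> \<nat> \<or> emeasure \<nu> B = \<infinity>"
    using assms by (auto simp: counting_measures_def)
  \<comment> \<open>If \<open>emeasure \<nu> B\<close> is infinite, then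
    \<open>measure \<nu> B\<close> is 0 by convention, so \<open>n = 0\<close> serves in that
    case.\<close>
  then obtain n where "measure \<nu> B = real n"
    by (auto simp: measure_def Nats_def intro: that[of 0])
  then show ?thesis by simp
qed

lemma count_vector_in_nat_vectors: "count_vector d A \<nu> \<in> nat_vectors d"
  by (simp add: count_vector_def nat_vectors_def)

lemma real_count_vector:
  assumes "\<nu> \<in> counting_measures" "A \<in> disjoint_borel_tuples d" "i < d"
  shows "real (count_vector d A \<nu> i) = measure \<nu> (A i)"
  using assms nat_floor_measure_counting[of \<nu> "A i"]
  by (simp add: count_vector_def disjoint_borel_tuples_def)

lemma countable_nat_vectors: "countable (nat_vectors d)"
  unfolding nat_vectors_def by (intro countable_PiE) auto

text \<open>The target is countable, so preimages of single vectors suffice, and such a preimage is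
  a finite intersection of events about one coordinate each.\<close>

lemma measurable_count_vector:
  assumes A: "A \<in> disjoint_borel_tuples d"
  shows "count_vector d A \<in> counting_algebra \<rightarrow>\<^sub>M count_space (nat_vectors d)"
proof (subst measurable_count_space_eq_countable[OF countable_nat_vectors], intro conjI ballI)
  show "count_vector d A \<in> space counting_algebra \<rightarrow> nat_vectors d"
    by (simp add: count_vector_in_nat_vectors)
next
  fix x assume x: "x \<in> nat_vectors d"
  have [measurable]: "(\<lambda>\<nu>. nat \<lfloor>measure \<nu> (A i)\<rfloor>) \<in> counting_algebra \<rightarrow>\<^sub>M count_space UNIV"
    if "i < d" for i
  proof -
    have [measurable]: "(\<lambda>\<nu>. emeasure \<nu> (A i)) \<in> borel_measurable counting_algebra"
      using A that by (intro measurable_emeasure_counting_algebra)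
        (simp add: disjoint_borel_tuples_def)
    show ?thesis unfolding measure_def by measurable
  qed
  have "{\<nu> \<in> space counting_algebra. \<forall>i\<in>{..<d}. nat \<lfloor>measure \<nu> (A i)\<rfloor> = x i}
      \<in> sets counting_algebra"
    by (intro sets.sets_Collect_finite_All) (auto intro!: pred_eq_const1[unfolded pred_def])
  \<comment> \<open>Both vectors are extensional, so agreement on \<open>{..<d}\<close> is already
    equality.\<close>
  also have "{\<nu> \<in> space counting_algebra. \<forall>i\<in>{..<d}. nat \<lfloor>measure \<nu> (A i)\<rfloor> = x i}
      = count_vector d A -` {x} \<inter> space counting_algebra"
    using x by (fastforce simp: count_vector_def nat_vectors_def fun_eq_iff PiE_def extensional_def
      split: if_splits)
  finally show "count_vector d A -` {x} \<inter> space counting_algebra \<in> sets counting_algebra" .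
qed

lemma dist_TV_commute: "dist_TV \<mu> \<nu> = dist_TV \<nu> \<mu>"
  unfolding dist_TV_def by (simp add: abs_minus_commute conj_commute)

lemma dist_TV_upper:
  assumes "B \<in> sets borel" "emeasure \<mu> B < \<infinity>" "emeasure \<nu> B < \<infinity>"
  shows "ennreal \<bar>measure \<mu> B - measure \<nu> B\<bar> \<le> dist_TV \<mu> \<nu>"
  unfolding dist_TV_def using assms by (intro SUP_upper) auto

text \<open>The set \<open>B\<close> is not admissible in the supremum, as its \<mu>-mass is
  infinite. By sigma-finiteness it has subsets of finite but arbitrarily large \<mu>-mass, whereas
  their \<nu>-mass stays below that of \<open>B\<close>.\<close>

lemma dist_TV_eq_infinity:
  assumes \<mu>: "\<mu> \<in> counting_measures" and \<nu>: "\<nu> \<in> counting_measures"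
    and B: "B \<in> sets borel" "emeasure \<mu> B = \<infinity>" "emeasure \<nu> B < \<infinity>"
  shows "dist_TV \<mu> \<nu> = \<infinity>"
proof -
  have [simp]: "sets \<mu> = sets borel" "sets \<nu> = sets borel"
    using \<mu> \<nu> by (auto simp: counting_measures_def)
  interpret \<mu>: sigma_finite_measure \<mu>
    using \<mu> by (simp add: counting_measures_def)
  have "of_nat n \<le> dist_TV \<mu> \<nu>" for n
  proof -
    \<comment> \<open>With this threshold, subtracting at most \<open>measure \<nu> B\<close> still
      leaves \<open>n\<close>.\<close>
    define C where "C = real n + measure \<nu> B"
    obtain Z where Z: "Z \<in> sets borel" "Z \<subseteq> B" "emeasure \<mu> Z < \<infinity>" "ennreal C < emeasure \<mu> Z"
      using \<mu>.approx_PInf_emeasure_with_finite[of B C] B by auto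
    have \<nu>Z: "emeasure \<nu> Z < \<infinity>"
      using emeasure_mono[of Z B \<nu>] Z B by (auto intro: le_less_trans)
    have "measure \<nu> Z \<le> measure \<nu> B"
      using Z B by (intro measure_mono_fmeasurable) (auto simp: fmeasurable_def)
    moreover have "0 \<le> C" by (simp add: C_def)
    then have "C < measure \<mu> Z"
      using Z by (simp add: emeasure_eq_ennreal_measure ennreal_less_iff)
    ultimately have "real n \<le> \<bar>measure \<mu> Z - measure \<nu> Z\<bar>"
      by (simp add: C_def)
    then have "ennreal (real n) \<le> ennreal \<bar>measure \<mu> Z - measure \<nu> Z\<bar>"
      by (rule ennreal_leI)
    also have "\<dots> \<le> dist_TV \<mu> \<nu>"
      using Z \<nu>Z by (intro dist_TV_upper)
    finally show ?thesis by (simp add: ennreal_of_nat_eq_real_of_nat)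
  qed
  then show ?thesis
    by (metis ennreal_Ex_less_of_nat infinity_ennreal_def not_less top.not_eq_extremum)
qed

lemma sum_abs_measure_diff_le_dist_TV:
  assumes \<mu>: "\<mu> \<in> counting_measures" and \<nu>: "\<nu> \<in> counting_measures" and fin: "finite I"
    and A: "\<And>i. i \<in> I \<Longrightarrow> A i \<in> sets borel" "disjoint_family_on A I"
    and less: "\<And>i. i \<in> I \<Longrightarrow> emeasure \<mu> (A i) < \<infinity>" "\<And>i. i \<in> I \<Longrightarrow> emeasure \<nu> (A i) < \<infinity>"
  shows "ennreal (\<Sum>i\<in>I. \<bar>measure \<mu> (A i) - measure \<nu> (A i)\<bar>) \<le> 2 * dist_TV \<mu> \<nu>"
proof -
  \<comment> \<open>By disjointness \<open>s J\<close> is the difference of the two masses of one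
    single set, the union over \<open>J\<close>.\<close>
  define s where "s J = (\<Sum>i\<in>J. measure \<mu> (A i) - measure \<nu> (A i))" for J
  have part: "ennreal \<bar>s J\<bar> \<le> dist_TV \<mu> \<nu>" if J: "J \<subseteq> I" for J
  proof -
    have finJ: "finite J" using J fin by (rule finite_subset)
    have disj: "disjoint_family_on A J" using A J by (auto simp: disjoint_family_on_def)
    have union: "(\<Union>i\<in>J. A i) \<in> sets borel" using A J finJ by (intro sets.finite_UN) auto
    \<comment> \<open>Finiteness of the individual masses makes the real-valued
      \<open>measure\<close> additive here and the union admissible for
      \<open>dist_TV\<close>.\<close>
    have *: "measure \<rho> (\<Union>i\<in>J. A i) = (\<Sum>i\<in>J. measure \<rho> (A i)) \<and> emeasure \<rho> (\<Union>i\<in>J. A i) < \<infinity>"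
      if \<rho>: "\<rho> \<in> counting_measures" "\<And>i. i \<in> I \<Longrightarrow> emeasure \<rho> (A i) < \<infinity>" for \<rho>
    proof
      have sets: "A ` J \<subseteq> sets \<rho>" using \<rho> A J by (auto simp: counting_measures_def)
      show "measure \<rho> (\<Union>i\<in>J. A i) = (\<Sum>i\<in>J. measure \<rho> (A i))"
        using J \<rho> by (intro measure_finite_Union finJ disj sets) fastforce
      have "emeasure \<rho> (\<Union>i\<in>J. A i) = (\<Sum>i\<in>J. emeasure \<rho> (A i))"
        using sum_emeasure[OF sets disj finJ] by simp
      also have "\<dots> < \<infinity>" using J \<rho> finJ by auto
      finally show "emeasure \<rho> (\<Union>i\<in>J. A i) < \<infinity>" .
    qed
    show ?thesis
      using dist_TV_upper[OF union, of \<mu> \<nu>] *[OF \<mu> less(1)] *[OF \<nu> less(2)]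
      by (simp add: s_def sum_subtractf)
  qed
  define J where "J = {i\<in>I. measure \<nu> (A i) \<le> measure \<mu> (A i)}"
  have "(\<Sum>i\<in>I. \<bar>measure \<mu> (A i) - measure \<nu> (A i)\<bar>)
      = (\<Sum>i\<in>J. \<bar>measure \<mu> (A i) - measure \<nu> (A i)\<bar>)
        + (\<Sum>i\<in>I - J. \<bar>measure \<mu> (A i) - measure \<nu> (A i)\<bar>)"
    using fin by (subst sum.subset_diff[of J]) (auto simp: J_def)
  \<comment> \<open>On \<open>I - J\<close> every difference is negative, which accounts for the
    minus sign.\<close>
  also have "\<dots> = s J - s (I - J)"
    unfolding s_def by (subst sum_negf[symmetric] diff_conv_add_uminus)+
      (auto simp: J_def intro!: arg_cong2[where f="(+)"] sum.cong)
  also have "\<dots> \<le> \<bar>s J\<bar> + \<bar>s (I - J)\<bar>" by simp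
  finally have "ennreal (\<Sum>i\<in>I. \<bar>measure \<mu> (A i) - measure \<nu> (A i)\<bar>)
      \<le> ennreal \<bar>s J\<bar> + ennreal \<bar>s (I - J)\<bar>"
    by (simp add: ennreal_leI flip: ennreal_plus)
  also have "\<dots> \<le> dist_TV \<mu> \<nu> + dist_TV \<mu> \<nu>"
    by (intro add_mono part) (auto simp: J_def)
  finally show ?thesis by (simp add: mult_2)
qed

lemma count_vector_diff_le_dist_TV:
  assumes \<mu>: "\<mu> \<in> counting_measures" and \<nu>: "\<nu> \<in> counting_measures"
    and A: "A \<in> disjoint_borel_tuples d"
  shows "ennreal (\<Sum>i<d. \<bar>real (count_vector d A \<mu> i) - real (count_vector d A \<nu> i)\<bar>)
    \<le> 2 * dist_TV \<mu> \<nu>"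
proof (cases "\<exists>i<d. (emeasure \<mu> (A i) = \<infinity>) \<noteq> (emeasure \<nu> (A i) = \<infinity>)")
  case True
  then obtain i where "i < d" "(emeasure \<mu> (A i) = \<infinity>) \<noteq> (emeasure \<nu> (A i) = \<infinity>)" by auto
  moreover from this have "A i \<in> sets borel" using A by (simp add: disjoint_borel_tuples_def)
  ultimately have "dist_TV \<mu> \<nu> = \<infinity>"
    using dist_TV_eq_infinity[OF \<mu> \<nu>, of "A i"] dist_TV_eq_infinity[OF \<nu> \<mu>, of "A i"]
    by (auto simp: dist_TV_commute[of \<nu> \<mu>] simp flip: less_top)
  then show ?thesis by (simp add: ennreal_mult_top)
next
  case False
  \<comment> \<open>By \<open>False\<close>, an index below \<open>d\<close> outside
    \<open>I\<close> has infinite mass under both measures. Both real values are then 0, so the sum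
    loses nothing when restricted to \<open>I\<close>.\<close>
  define I where "I = {i. i < d \<and> emeasure \<mu> (A i) < \<infinity>}"
  have "(\<Sum>i<d. \<bar>real (count_vector d A \<mu> i) - real (count_vector d A \<nu> i)\<bar>)
      = (\<Sum>i<d. \<bar>measure \<mu> (A i) - measure \<nu> (A i)\<bar>)"
    using \<mu> \<nu> A by (simp add: real_count_vector)
  also have "\<dots> = (\<Sum>i\<in>I. \<bar>measure \<mu> (A i) - measure \<nu> (A i)\<bar>)"
    using False by (intro sum.mono_neutral_right) (auto simp: I_def measure_def simp flip: less_top)
  also have "ennreal \<dots> \<le> 2 * dist_TV \<mu> \<nu>"
    using A False by (intro sum_abs_measure_diff_le_dist_TV \<mu> \<nu>)
      (auto simp: I_def disjoint_borel_tuples_def disjoint_family_on_def less_top)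
  finally show ?thesis .
qed

lemma half_lipschitz_count_vector:
  assumes A: "A \<in> disjoint_borel_tuples d" and g: "g \<in> lipschitz1_vec d"
  shows "(\<lambda>\<nu>. g (count_vector d A \<nu>) / 2) \<in> lipschitz1_TV"
  unfolding lipschitz1_TV_def
proof (intro CollectI conjI ballI)
  \<comment> \<open>Every function on a discrete space is measurable, so measurability of
    \<open>h\<close> comes from the count vector alone.\<close>
  have "g \<in> borel_measurable (count_space (nat_vectors d))" by simp
  from measurable_compose[OF measurable_count_vector[OF A] this]
  show "(\<lambda>\<nu>. g (count_vector d A \<nu>) / 2) \<in> borel_measurable counting_algebra"
    by measurable
next
  fix \<mu> \<nu> :: "'a measure"
  assume "\<mu> \<in> counting_measures" "\<nu> \<in> counting_measures"
  have "2 * ennreal \<bar>g (count_vector d A \<mu>) / 2 - g (count_vector d A \<nu>) / 2\<bar>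
      = ennreal \<bar>g (count_vector d A \<mu>) - g (count_vector d A \<nu>)\<bar>"
    by (simp add: diff_divide_distrib[symmetric] ennreal_mult'[symmetric]
        flip: ennreal_numeral)
  also have "\<dots> \<le> ennreal (\<Sum>i<d. \<bar>real (count_vector d A \<mu> i) - real (count_vector d A \<nu> i)\<bar>)"
    using g count_vector_in_nat_vectors[of d A \<mu>] count_vector_in_nat_vectors[of d A \<nu>]
    unfolding lipschitz1_vec_def by (intro ennreal_leI) blast
  also have "\<dots> \<le> 2 * dist_TV \<mu> \<nu>"
    by (rule count_vector_diff_le_dist_TV) fact+
  finally show "ennreal \<bar>g (count_vector d A \<mu>) / 2 - g (count_vector d A \<nu>) / 2\<bar> \<le> dist_TV \<mu> \<nu>"
    by (simp add: ennreal_mult_le_mult_iff)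
qed

text \<open>The real-valued mass never exceeds the extended one, whose expectation is the intensity
  of \<open>B\<close>.\<close>

lemma integrable_measure_point_process:
  fixes \<xi> :: "'w \<Rightarrow> 'a::topological_space measure"
  assumes pp: "point_process M \<xi>" and fin: "finite_measure (intensity M \<xi>)"
    and B: "B \<in> sets borel"
  shows "integrable M (\<lambda>\<omega>. measure (\<xi> \<omega>) B)"
proof (rule integrableI_bounded)
  note [measurable] = point_process_measurable_emeasure[OF pp B]
  show "(\<lambda>\<omega>. measure (\<xi> \<omega>) B) \<in> borel_measurable M"
    unfolding measure_def by measurable
  have "(\<integral>\<^sup>+\<omega>. ennreal (norm (measure (\<xi> \<omega>) B)) \<partial>M) \<le> (\<integral>\<^sup>+\<omega>. emeasure (\<xi> \<omega>) B \<partial>M)"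
    by (intro nn_integral_mono) (simp add: measure_def ennreal_enn2real_if)
  also have "\<dots> = emeasure (intensity M \<xi>) B"
    using pp B by (simp add: emeasure_intensity)
  also have "\<dots> < \<infinity>"
    using finite_measure.emeasure_finite[OF fin, of B] by (simp add: less_top)
  finally show "(\<integral>\<^sup>+\<omega>. ennreal (norm (measure (\<xi> \<omega>) B)) \<partial>M) < \<infinity>" .
qed

text \<open>A 1-Lipschitz function grows at most linearly: its absolute value is at most the one at
  the zero vector plus the sum of the counts. This yields the integrability that
  \<open>dist_KR\<close> demands of its test functions.\<close>

lemma integrable_lipschitz_count_vector:
  fixes \<xi> :: "'w \<Rightarrow> 'a::topological_space measure"
  assumes pp: "point_process M \<xi>" and fin: "finite_measure (intensity M \<xi>)"
    and A: "A \<in> disjoint_borel_tuples d" and g: "g \<in> lipschitz1_vec d"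
  shows "integrable M (\<lambda>\<omega>. g (count_vector d A (\<xi> \<omega>)))"
proof (rule Bochner_Integration.integrable_bound)
  interpret prob_space M using pp by (simp add: point_process_def)
  \<comment> \<open>The zero vector is restricted to \<open>{..<d}\<close> so that it lies in
    \<open>nat_vectors d\<close>, where the Lipschitz bound of \<open>g\<close> applies.\<close>
  let ?z = "\<lambda>i\<in>{..<d}. 0 :: nat"
  show "integrable M (\<lambda>\<omega>. \<bar>g ?z\<bar> + (\<Sum>i<d. measure (\<xi> \<omega>) (A i)))"
    using A by (intro Bochner_Integration.integrable_add Bochner_Integration.integrable_sum
        integrable_measure_point_process[OF pp fin]) (auto simp: disjoint_borel_tuples_def)
  have \<xi>: "\<xi> \<in> M \<rightarrow>\<^sub>M counting_algebra" using pp by (simp add: point_process_def)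
  have "g \<in> borel_measurable (count_space (nat_vectors d))" by simp
  from measurable_compose[OF measurable_compose[OF \<xi> measurable_count_vector[OF A]] this]
  show "(\<lambda>\<omega>. g (count_vector d A (\<xi> \<omega>))) \<in> borel_measurable M" .
  show "AE \<omega> in M. norm (g (count_vector d A (\<xi> \<omega>)))
      \<le> norm (\<bar>g ?z\<bar> + (\<Sum>i<d. measure (\<xi> \<omega>) (A i)))"
  proof (rule AE_I2)
    fix \<omega> assume "\<omega> \<in> space M"
    then have cm: "\<xi> \<omega> \<in> counting_measures"
      using point_process_in_counting_measures[OF pp] by simp
    have "?z \<in> nat_vectors d" by (simp add: nat_vectors_def)
    then have "\<bar>g (count_vector d A (\<xi> \<omega>)) - g ?z\<bar>
        \<le> (\<Sum>i<d. \<bar>real (count_vector d A (\<xi> \<omega>) i) - real (?z i)\<bar>)"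
      using g count_vector_in_nat_vectors[of d A "\<xi> \<omega>"] unfolding lipschitz1_vec_def by blast
    also have "\<dots> = (\<Sum>i<d. measure (\<xi> \<omega>) (A i))"
      by (intro sum.cong) (simp_all add: real_count_vector[OF cm A])
    finally show "norm (g (count_vector d A (\<xi> \<omega>)))
        \<le> norm (\<bar>g ?z\<bar> + (\<Sum>i<d. measure (\<xi> \<omega>) (A i)))"
      by simp
  qed
qed

theorem lemma2p6:
  fixes M :: "'w measure" and N :: "'v measure"
    and \<xi> :: "'w \<Rightarrow> 'a::{second_countable_topology, t2_space} measure"
    and \<zeta> :: "'v \<Rightarrow> 'a measure"
  assumes "locally_compact_space (euclidean :: 'a topology)"
    and "point_process M \<xi>" and "finite_measure (intensity M \<xi>)"
    and "point_process N \<zeta>" and "finite_measure (intensity N \<zeta>)"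
  shows "dist_pi M \<xi> N \<zeta> \<le> 2 * dist_KR M \<xi> N \<zeta>"
  unfolding dist_pi_def dist_W_def
proof (intro SUP_least)
  fix d and A :: "nat \<Rightarrow> 'a set" and g
  assume A: "A \<in> disjoint_borel_tuples d" and g: "g \<in> lipschitz1_vec d"
  \<comment> \<open>Halving turns the Lipschitz constant 2 into 1; the factor returns as the 2 in
    front of \<open>dist_KR\<close>.\<close>
  define h where "h \<nu> = g (count_vector d A \<nu>) / 2" for \<nu> :: "'a measure"
  have "h \<in> lipschitz1_TV"
    using half_lipschitz_count_vector[OF A g] by (simp add: h_def[abs_def])
  moreover have "integrable M (\<lambda>\<omega>. h (\<xi> \<omega>))" "integrable N (\<lambda>\<omega>. h (\<zeta> \<omega>))"
    unfolding h_def using assms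
    by (auto intro!: integrable_lipschitz_count_vector[OF _ _ A g])
  ultimately have "ennreal \<bar>(\<integral>\<omega>. h (\<xi> \<omega>) \<partial>M) - (\<integral>\<omega>. h (\<zeta> \<omega>) \<partial>N)\<bar> \<le> dist_KR M \<xi> N \<zeta>"
    unfolding dist_KR_def by (intro SUP_upper) simp
  then have "2 * ennreal \<bar>(\<integral>\<omega>. h (\<xi> \<omega>) \<partial>M) - (\<integral>\<omega>. h (\<zeta> \<omega>) \<partial>N)\<bar> \<le> 2 * dist_KR M \<xi> N \<zeta>"
    by (intro mult_left_mono) simp_all
  moreover have "2 * ennreal \<bar>(\<integral>\<omega>. h (\<xi> \<omega>) \<partial>M) - (\<integral>\<omega>. h (\<zeta> \<omega>) \<partial>N)\<bar>
      = ennreal \<bar>(\<integral>\<omega>. g (count_vector d A (\<xi> \<omega>)) \<partial>M) - (\<integral>\<omega>. g (count_vector d A (\<zeta> \<omega>)) \<partial>N)\<bar>"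
    by (simp add: h_def diff_divide_distrib[symmetric] ennreal_mult'[symmetric]
        flip: ennreal_numeral)
  ultimately show "ennreal \<bar>(\<integral>\<omega>. g (count_vector d A (\<xi> \<omega>)) \<partial>M)
      - (\<integral>\<omega>. g (count_vector d A (\<zeta> \<omega>)) \<partial>N)\<bar> \<le> 2 * dist_KR M \<xi> N \<zeta>"
    by simp
qed

end
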